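(* Let $G$ be a unital $f$-ring with unit element $e_G$, let $H$ be an archimedean $f$-ring, and let $T:G\to H$ be a positive group homomorphism (i.e. $T$ is additive and $T(a)\ge 0$ whenever $a\ge 0$). Then $T$ is a ring homomorphism (i.e. $T(ab)=T(a)T(b)$ for all $a,b\in G$) if and only if $T$ is an $\ell$-homomorphism and $T(e_G)$ is idempotent (i.e. $T(e_G)^2=T(e_G)$).
   Context: An $f$-ring is an (associative) lattice-ordered ring (a ring whose additive group is a lattice-ordered group and in which products of positive elements are positive) such that $a\wedge b=0$ and $c\ge 0$ imply $(ac)\wedge b=(ca)\wedge b=0$; it need not have a unit. It is unital if it has a multiplicative unit. It is archimedean if $a,b\ge 0$ and $na\le b$ for all $n\in\mathbb{N}$ imply $a=0$. An $\ell$-homomorphism is a group homomorphism (for addition) that is also a lattice homomorphism. Ring homomorphisms are not required to preserve units ($H$ need not be unital). *)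

theory Defs
  imports "HOL-Library.Lattice_Algebras"
begin

class f_ring = lattice_ring +
  assumes inf_mult_right_eq_0: "inf a b = 0 \<Longrightarrow> 0 \<le> c \<Longrightarrow> inf (a * c) b = 0"
    and inf_mult_left_eq_0: "inf a b = 0 \<Longrightarrow> 0 \<le> c \<Longrightarrow> inf (c * a) b = 0"

(* The n-fold multiple is a repeated sum: without a unit there is no of_nat n. *)
class archimedean_f_ring = f_ring +
  assumes archimedean: "0 \<le> a \<Longrightarrow> 0 \<le> b \<Longrightarrow> (\<And>n::nat. (\<Sum>i<n. a) \<le> b) \<Longrightarrow> a = 0"

(* As the rings need not be unital, preservation of units is not required. *)
definition ring_homomorphism :: "('a::ring \<Rightarrow> 'b::ring) \<Rightarrow> bool" where
  "ring_homomorphism T \<longleftrightarrow> additive T \<and> (\<forall>a b. T (a * b) = T a * T b)"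

definition l_homomorphism ::
    "('a::lattice_ab_group_add \<Rightarrow> 'b::lattice_ab_group_add) \<Rightarrow> bool" where
  "l_homomorphism T \<longleftrightarrow>
     additive T \<and> (\<forall>a b. T (inf a b) = inf (T a) (T b)) \<and> (\<forall>a b. T (sup a b) = sup (T a) (T b))"

definition positive_homomorphism ::
    "('a::ordered_ab_group_add \<Rightarrow> 'b::ordered_ab_group_add) \<Rightarrow> bool" where
  "positive_homomorphism T \<longleftrightarrow> additive T \<and> (\<forall>a. 0 \<le> a \<longrightarrow> 0 \<le> T a)"

end

theory Submission
  imports Defs
begin

text \<open>
  Say that \<open>a\<close> and \<open>b\<close> are disjoint if \<open>inf a b = 0\<close>. An additive map is an
  \<open>\<ell>\<close>-homomorphism as soon as it preserves disjointness, and in an \<open>f\<close>-ring multiplication by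
  positive elements preserves disjointness. Both directions are arguments about disjoint elements,
  in which the archimedean property is used to kill elements that behave like infinitesimals.
  Write \<open>p\<close> for the image of the unit \<open>e\<close>.

  Let \<open>T\<close> be multiplicative. Disjoint \<open>a, b\<close> have product \<open>0\<close>, so \<open>x = inf (T a) (T b)\<close>
  satisfies \<open>0 \<le> x * x \<le> T a * T b = 0\<close>. An archimedean \<open>f\<close>-ring may contain nonzero nilpotents,
  but they annihilate the whole ring (\<open>square_zero_imp_annihilates\<close>). On the other hand
  \<open>p * x = inf (p * T a) (p * T b) = x\<close>. Hence \<open>x = 0\<close>.

  Conversely, let \<open>T\<close> be an \<open>\<ell>\<close>-homomorphism and \<open>p\<close> idempotent. The main point is that \<open>p\<close> acts
  as a left unit on the range of \<open>T\<close> (\<open>idempotent_image_mult\<close>). For a fixed \<open>b \<ge> 0\<close>, the positive maps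
  \<open>S a = T (a * b)\<close> and \<open>R a = T a * T b\<close> then agree at \<open>e\<close>, and \<open>S c\<close> is disjoint from \<open>R d\<close>
  whenever \<open>c\<close> is disjoint from \<open>d\<close>. Two such maps coincide (\<open>positive_maps_agree\<close>): cutting \<open>a\<close>
  into horizontal layers of height \<open>e\<close>, the cross-disjointness bounds \<open>S\<close> on each layer by \<open>R\<close>
  on the layer just below, so that \<open>S a \<le> R a + S e\<close> for every \<open>a\<close> below a multiple of \<open>e\<close>.
  Applied to the multiples of \<open>a\<close>, this gives \<open>S a \<le> R a\<close>. Elements that lie below no multiple
  of \<open>e\<close> are reduced to those that do by the estimate \<open>n * pprt (a - n * e) \<le> a * a\<close>, which says
  that the excess of \<open>a\<close> over \<open>n * e\<close> becomes infinitesimal.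
\<close>

section \<open>Natural multiples\<close>

definition multiple :: "nat \<Rightarrow> 'a::comm_monoid_add \<Rightarrow> 'a" where
  "multiple n a = (\<Sum>i<n. a)"

lemma multiple_0 [simp]: "multiple 0 a = 0"
  by (simp add: multiple_def)

lemma multiple_Suc [simp]: "multiple (Suc n) a = multiple n a + a"
  by (simp add: multiple_def)

lemma multiple_zero_right [simp]: "multiple n 0 = 0"
  by (simp add: multiple_def)

lemma multiple_diff:
  fixes a b :: "'a::ab_group_add"
  shows "multiple n (a - b) = multiple n a - multiple n b"
  by (simp add: multiple_def sum_subtractf)

lemma multiple_add_left: "multiple (m + n) a = multiple m a + multiple n a"
  by (induction n) (simp_all add: add.assoc)

lemma multiple_multiple: "multiple m (multiple n a) = multiple (m * n) a"
  by (induction m) (simp_all add: multiple_add_left add.commute)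

lemma multiple_mono:
  fixes a b :: "'a::ordered_ab_group_add"
  shows "a \<le> b \<Longrightarrow> multiple n a \<le> multiple n b"
  by (simp add: multiple_def sum_mono)

lemma multiple_nonneg:
  fixes a :: "'a::ordered_ab_group_add"
  shows "0 \<le> a \<Longrightarrow> 0 \<le> multiple n a"
  using multiple_mono[of 0 a n] by simp

lemma multiple_mult_left:
  fixes a b :: "'a::ring"
  shows "multiple n a * b = multiple n (a * b)"
  by (simp add: multiple_def sum_distrib_right)

lemma multiple_mult_right:
  fixes a b :: "'a::ring"
  shows "a * multiple n b = multiple n (a * b)"
  by (simp add: multiple_def sum_distrib_left)

lemma additive_multiple: "additive f \<Longrightarrow> f (multiple n a) = multiple n (f a)"
  by (simp add: multiple_def additive.sum)

section \<open>Disjointness in lattice-ordered groups\<close>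

context lattice_ab_group_add
begin

lemma disjoint_nonneg:
  assumes "inf a b = 0"
  shows "0 \<le> a" "0 \<le> b"
  using assms inf_le1[of a b] inf_le2[of a b] by simp_all

lemma pprt_nonneg: "0 \<le> pprt x"
  by (simp add: pprt_def)

lemma pprt_ge: "x \<le> pprt x"
  by (simp add: pprt_def)

lemma pprt_least: "x \<le> y \<Longrightarrow> 0 \<le> y \<Longrightarrow> pprt x \<le> y"
  by (simp add: pprt_def)

lemma pprt_minus_pprt_uminus: "pprt x - pprt (- x) = x"
  using prts[of x] by (simp add: pprt_neg)

lemma disjoint_diff_inf: "inf (a - inf a b) (b - inf a b) = 0"
  using add_inf_distrib_right[of a b "- inf a b"] by (metis diff_conv_add_uminus diff_self)

lemma diff_inf_eq_pprt: "a - inf a b = pprt (a - b)"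
  by (simp add: pprt_def diff_inf_eq_sup add_sup_distrib_left sup_commute)

lemma inf_add_pprt_diff: "inf a b + pprt (a - b) = a"
  by (metis add_diff_cancel_left' diff_add_cancel diff_inf_eq_pprt add.commute)

lemma disjoint_pprt: "inf (pprt x) (pprt (- x)) = 0"
  using disjoint_diff_inf[of x 0] diff_inf_eq_pprt[of x 0] diff_inf_eq_pprt[of 0 x]
  by (simp add: inf_commute)

lemma pprt_diff_disjoint: "inf u v = 0 \<Longrightarrow> pprt (u - v) = u"
  by (metis diff_inf_eq_pprt diff_zero)

lemma disjoint_add_eq_sup: "inf u v = 0 \<Longrightarrow> sup u v = u + v"
  using add_eq_inf_sup[of u v] by simp

lemma disjoint_add:
  assumes "inf a c = 0" "inf b c = 0"
  shows "inf (a + b) c = 0"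
proof (rule order.antisym)
  let ?t = "inf (a + b) c"
  have "?t - b \<le> a"
    by (simp add: diff_le_eq)
  moreover have "?t - b \<le> c"
    using add_mono[OF inf_le2[of "a + b" c] disjoint_nonneg(1)[OF assms(2)]]
    by (simp add: diff_le_eq)
  ultimately have "?t - b \<le> inf a c"
    by simp
  then have "?t \<le> b"
    by (simp add: assms(1))
  then have "?t \<le> inf b c"
    by simp
  then show "?t \<le> 0"
    by (simp add: assms(2))
  show "0 \<le> ?t"
    using assms disjoint_nonneg by simp
qed

lemma disjoint_mono:
  assumes "inf a b = 0" "0 \<le> a'" "a' \<le> a" "0 \<le> b'" "b' \<le> b"
  shows "inf a' b' = 0"
  using assms inf_mono[of a' a b' b] by (simp add: order.antisym)

lemma disjoint_imp_le_summand:
  assumes "x \<le> u + v" "inf x v = 0" "0 \<le> u"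
  shows "x \<le> u"
proof -
  have "x - u \<le> inf x v"
    using assms(1,3) by (simp add: diff_le_eq add.commute)
  then show ?thesis
    by (simp add: assms(2))
qed

end

lemma disjoint_multiple:
  fixes a b :: "'a::lattice_ab_group_add"
  assumes "inf a b = 0"
  shows "inf (multiple n a) b = 0"
  using assms disjoint_nonneg(2)[OF assms]
  by (induction n) (simp_all add: disjoint_add inf_absorb1)

lemma pprt_multiple:
  fixes x :: "'a::lattice_ab_group_add"
  shows "pprt (multiple n x) = multiple n (pprt x)"
proof -
  have "inf (multiple n (pprt x)) (multiple n (pprt (- x))) = 0"
    using disjoint_multiple[OF disjoint_pprt] disjoint_multiple by (metis inf_commute)
  then show ?thesis
    by (metis multiple_diff pprt_diff_disjoint pprt_minus_pprt_uminus)
qed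

text \<open>
  By translation invariance, everything about an \<open>\<ell>\<close>-homomorphism can be checked on the disjoint
  pair \<open>a - inf a b\<close>, \<open>b - inf a b\<close>.
\<close>

lemma l_homomorphismI_disjoint:
  assumes "additive T" and disj: "\<And>a b. inf a b = 0 \<Longrightarrow> inf (T a) (T b) = 0"
  shows "l_homomorphism T"
proof -
  interpret additive T by fact
  have inf: "T (inf a b) = inf (T a) (T b)" for a b
  proof -
    have "inf (T a - T (inf a b)) (T b - T (inf a b)) = 0"
      using disj[OF disjoint_diff_inf[of a b]] by (simp only: diff)
    then show ?thesis
      using add_inf_distrib_right[of "T a" "T b" "- T (inf a b)"] by simp
  qed
  have "T (sup a b) = sup (T a) (T b)" for a b
    using add_eq_inf_sup[of a b] add_eq_inf_sup[of "T a" "T b"] inf[of a b]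
    by (metis add add_right_imp_eq)
  with inf show ?thesis
    using assms(1) by (simp add: l_homomorphism_def)
qed

section \<open>Order and multiplication in f-rings\<close>

lemma disjoint_mult_left:
  fixes a b c :: "'a::f_ring"
  shows "inf a b = 0 \<Longrightarrow> 0 \<le> c \<Longrightarrow> inf (c * a) (c * b) = 0"
  using inf_mult_left_eq_0 by (metis inf_commute)

lemma disjoint_mult_eq_0:
  fixes a b :: "'a::f_ring"
  assumes "inf a b = 0"
  shows "a * b = 0"
proof -
  have "inf (a * b) b = 0"
    using assms disjoint_nonneg(2)[OF assms] by (rule inf_mult_right_eq_0)
  then have "inf b (a * b) = 0"
    by (simp add: inf_commute)
  from inf_mult_left_eq_0[OF this disjoint_nonneg(1)[OF assms]] show ?thesis
    by simp
qed

lemma mult_inf_distrib_left: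
  fixes a b c :: "'a::f_ring"
  assumes "0 \<le> c"
  shows "c * inf a b = inf (c * a) (c * b)"
proof -
  have "inf (c * a - c * inf a b) (c * b - c * inf a b) = 0"
    using disjoint_mult_left[OF disjoint_diff_inf[of a b] assms] by (simp only: right_diff_distrib)
  then show ?thesis
    using add_inf_distrib_right[of "c * a" "c * b" "- (c * inf a b)"] by simp
qed

lemma mult_pprt_left:
  fixes c x :: "'a::f_ring"
  assumes "0 \<le> c"
  shows "c * pprt x = pprt (c * x)"
  using pprt_diff_disjoint[OF disjoint_mult_left[OF disjoint_pprt[of x] assms]]
  by (simp add: pprt_minus_pprt_uminus flip: right_diff_distrib)

lemma mult_pprt_self:
  fixes x :: "'a::f_ring"
  shows "x * pprt x = pprt x * pprt x"
proof -
  have "pprt (- x) * pprt x = 0"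
    using disjoint_pprt[of x] by (simp add: disjoint_mult_eq_0 inf_commute)
  then have "(pprt x - pprt (- x)) * pprt x = pprt x * pprt x"
    by (simp add: left_diff_distrib)
  then show ?thesis
    by (simp add: pprt_minus_pprt_uminus)
qed

lemma square_nonneg:
  fixes x :: "'a::f_ring"
  shows "0 \<le> x * x"
proof -
  let ?u = "pprt x" and ?v = "pprt (- x)"
  have "?u * ?v = 0" "?v * ?u = 0"
    using disjoint_pprt[of x] by (simp_all add: disjoint_mult_eq_0 inf_commute)
  then have "(?u - ?v) * (?u - ?v) = ?u * ?u + ?v * ?v"
    by (simp add: algebra_simps)
  then show ?thesis
    by (simp add: pprt_minus_pprt_uminus mult_nonneg_nonneg pprt_nonneg)
qed

lemma mult_le_sum_squares:
  fixes a b :: "'a::f_ring"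
  assumes "0 \<le> a" "0 \<le> b"
  shows "a * b \<le> a * a + b * b"
proof -
  have "0 \<le> (a - b) * (a - b)"
    by (rule square_nonneg)
  then have "a * b + b * a \<le> a * a + b * b"
    by (simp add: algebra_simps)
  moreover have "a * b \<le> a * b + b * a"
    using mult_nonneg_nonneg[OF assms(2,1)] by simp
  ultimately show ?thesis
    by (rule order.trans[rotated])
qed

text \<open>
  Where \<open>a\<close> exceeds \<open>n * e\<close>, one has \<open>a * a \<ge> n * a\<close>; elsewhere the left-hand side vanishes. So an
  element that is not bounded by a multiple of the unit is still approximated by its truncations,
  with an error that is controlled by its square.
\<close>

lemma multiple_excess_le_square:
  fixes a e :: "'a::f_ring"
  assumes e: "\<And>a. e * a = a" "0 \<le> e" and a: "0 \<le> a"
  shows "multiple n (pprt (a - multiple n e)) \<le> a * a"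
proof -
  let ?c = "pprt (a - multiple n e)"
  have "(a - multiple n e) * ?c = a * ?c - multiple n ?c"
    by (simp add: left_diff_distrib multiple_mult_left e(1))
  then have "0 \<le> a * ?c - multiple n ?c"
    using square_nonneg[of ?c] by (simp add: mult_pprt_self)
  then have "multiple n ?c \<le> a * ?c"
    by simp
  also have "?c \<le> a"
    using a multiple_nonneg[OF e(2)] by (intro pprt_least) simp_all
  then have "a * ?c \<le> a * a"
    using a by (rule mult_left_mono)
  finally show ?thesis .
qed

section \<open>Archimedean f-rings\<close>

lemma archimedean_nonpos:
  fixes y b :: "'a::archimedean_f_ring"
  assumes "\<And>n. multiple n y \<le> b"
  shows "y \<le> 0"
proof -
  have b: "0 \<le> b"
    using assms[of 0] by simp
  have "multiple n (pprt y) \<le> b" for n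
    unfolding pprt_multiple[symmetric] using assms b by (rule pprt_least)
  then have "pprt y = 0"
    using b pprt_nonneg by (intro archimedean) (simp_all add: multiple_def)
  then show ?thesis
    by (simp add: le_zero_iff_zero_pprt)
qed

text \<open>As \<open>x * x = 0\<close>, expanding \<open>(n * x - y)\<^sup>2 \<ge> 0\<close> bounds \<open>n * (x * y)\<close> and \<open>n * (y * x)\<close> by \<open>y\<^sup>2\<close>, for
  every \<open>n\<close>.\<close>

lemma square_zero_imp_annihilates:
  fixes x y :: "'a::archimedean_f_ring"
  assumes "0 \<le> x" "x * x = 0" "0 \<le> y"
  shows "x * y = 0" "y * x = 0"
proof -
  have "multiple n (x * y) \<le> y * y" "multiple n (y * x) \<le> y * y" for n
    using mult_le_sum_squares[OF multiple_nonneg[OF assms(1)] assms(3), of n]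
      mult_le_sum_squares[OF assms(3) multiple_nonneg[OF assms(1)], of n] assms(2)
    by (simp_all add: multiple_mult_left multiple_mult_right)
  from this[THEN archimedean_nonpos] have "x * y \<le> 0" "y * x \<le> 0" .
  then show "x * y = 0" "y * x = 0"
    using assms by (simp_all add: mult_nonneg_nonneg order.antisym)
qed

text \<open>
  In a totally ordered \<open>f\<close>-ring, \<open>p \<le> m * w\<close> would give \<open>p = p * p \<le> m * (p * w) = 0\<close>. So there all
  multiples of \<open>w\<close> lie below \<open>p\<close>, unless \<open>p = 0\<close>. Replacing \<open>w\<close> by \<open>v = inf w p\<close> covers the latter
  case too and leads to \<open>n * v \<le> p\<close> in general. The proof expresses the totally ordered argument
  by the positive part of \<open>n * v - p\<close>.
\<close>

lemma idempotent_disjoint_annihilated: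
  fixes p w :: "'a::archimedean_f_ring"
  assumes p: "0 \<le> p" "p * p = p" and w: "0 \<le> w" "p * w = 0"
  shows "inf w p = 0"
proof (rule order.antisym)
  let ?v = "inf w p"
  have pv: "p * ?v = 0"
    by (simp add: mult_inf_distrib_left p w inf_absorb1)
  have v: "0 \<le> ?v"
    using p w by simp
  have "multiple n ?v \<le> p" for n
  proof -
    let ?x = "multiple n ?v - p"
    have "p * (- ?x) = p"
      by (simp add: right_diff_distrib multiple_mult_right pv p(2))
    then have "p * pprt (- ?x) = p"
      using p(1) by (simp add: mult_pprt_left)
    with inf_mult_left_eq_0[of "pprt (- ?x)" "pprt ?x" p] have "inf p (pprt ?x) = 0"
      using p(1) disjoint_pprt[of ?x] by (simp add: inf_commute)
    then have "inf (multiple n p) (pprt ?x) = 0"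
      by (rule disjoint_multiple)
    moreover have "pprt ?x \<le> multiple n p"
    proof (rule pprt_least)
      have "?x \<le> multiple n ?v"
        using p(1) by simp
      also have "\<dots> \<le> multiple n p"
        by (rule multiple_mono) simp
      finally show "?x \<le> multiple n p" .
    qed (simp add: multiple_nonneg p(1))
    ultimately have "pprt ?x = 0"
      by (simp add: inf_absorb2)
    then show ?thesis
      by (simp flip: le_zero_iff_zero_pprt)
  qed
  then show "?v \<le> 0"
    by (rule archimedean_nonpos)
qed (use p w in simp)

text \<open>The part of \<open>p * h\<close> above \<open>h\<close> is annihilated by \<open>p\<close>, hence disjoint from \<open>p\<close> and from
  \<open>p * h\<close>; but it also lies below \<open>p * h\<close>.\<close>

lemma idempotent_mult_le:
  fixes p h :: "'a::archimedean_f_ring"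
  assumes p: "0 \<le> p" "p * p = p" and h: "0 \<le> h"
  shows "p * h \<le> h"
proof -
  let ?w = "pprt (p * h - h)"
  have "p * ?w = 0"
    using p by (simp add: mult_pprt_left right_diff_distrib flip: mult.assoc)
  then have "inf p ?w = 0"
    using idempotent_disjoint_annihilated[OF p pprt_nonneg] by (simp add: inf_commute)
  then have "inf (p * h) ?w = 0"
    using h by (rule inf_mult_right_eq_0)
  moreover have "?w \<le> p * h"
    using p(1) h by (intro pprt_least) (simp_all add: mult_nonneg_nonneg)
  ultimately have "?w = 0"
    by (simp add: inf_absorb2)
  then show ?thesis
    by (simp flip: le_zero_iff_zero_pprt)
qed

section \<open>Positive homomorphisms from a unital f-ring\<close>

lemma positive_homomorphism_mono:
  assumes "positive_homomorphism T" "a \<le> b"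
  shows "T a \<le> T b"
proof -
  have "0 \<le> T (b - a)"
    using assms by (simp add: positive_homomorphism_def)
  then show ?thesis
    using assms(1) by (simp add: positive_homomorphism_def additive.diff)
qed

lemma positive_homomorphism_nonneg: "positive_homomorphism T \<Longrightarrow> 0 \<le> a \<Longrightarrow> 0 \<le> T a"
  by (simp add: positive_homomorphism_def)

text \<open>
  The defect \<open>z = T a - p * T a\<close> is disjoint from \<open>p = T e\<close>. Since \<open>n * a \<le> a * a + n\<^sup>2 * e\<close>, its
  multiple \<open>n * z\<close> lies below \<open>T (a * a) + n\<^sup>2 * p\<close>, and by disjointness already below \<open>T (a * a)\<close>.
\<close>

lemma idempotent_image_mult:
  fixes T :: "'g::f_ring \<Rightarrow> 'h::archimedean_f_ring"
  assumes e: "\<And>a. e * a = a" "0 \<le> e"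
    and T: "positive_homomorphism T"
    and idem: "T e * T e = T e"
    and a: "0 \<le> a"
  shows "T e * T a = T a"
proof (rule order.antisym)
  interpret additive T
    using T by (simp add: positive_homomorphism_def)
  let ?p = "T e" and ?z = "T a - T e * T a"
  have p: "0 \<le> ?p"
    using T e(2) by (rule positive_homomorphism_nonneg)
  have Ta: "0 \<le> T a"
    using T a by (rule positive_homomorphism_nonneg)
  show le: "?p * T a \<le> T a"
    using p idem Ta by (rule idempotent_mult_le)
  have "?p * ?z = 0"
    by (simp add: right_diff_distrib idem flip: mult.assoc)
  with le have disj: "inf ?z ?p = 0"
    by (intro idempotent_disjoint_annihilated p idem) simp_all
  have "multiple n ?z \<le> T (a * a)" for n
  proof (rule disjoint_imp_le_summand)
    have "?z \<le> T a"
      using p Ta by (simp add: mult_nonneg_nonneg)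
    then have "multiple n ?z \<le> multiple n (T a)"
      by (rule multiple_mono)
    also have "\<dots> = T (multiple n a)"
      by (simp add: additive_multiple additive_axioms)
    also have "multiple n (a - multiple n e) \<le> a * a"
      using multiple_mono[OF pprt_ge] multiple_excess_le_square[OF e a] by (rule order.trans)
    then have "multiple n a \<le> a * a + multiple n (multiple n e)"
      by (simp add: multiple_diff diff_le_eq)
    then have "T (multiple n a) \<le> T (a * a) + T (multiple n (multiple n e))"
      unfolding add[symmetric] by (rule positive_homomorphism_mono[OF T])
    finally show "multiple n ?z \<le> T (a * a) + multiple n (multiple n ?p)"
      by (simp add: additive_multiple additive_axioms)
    show "inf (multiple n ?z) (multiple n (multiple n ?p)) = 0"
      using disj by (metis disjoint_multiple inf_commute)
    show "0 \<le> T (a * a)"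
      using T square_nonneg by (rule positive_homomorphism_nonneg)
  qed
  then have "?z \<le> 0"
    by (rule archimedean_nonpos)
  then show "T a \<le> ?p * T a"
    by simp
qed

text \<open>
  The layering argument. Where \<open>pprt (x - e)\<close> does not vanish, \<open>x\<close> exceeds \<open>e\<close>. So the next layer
  \<open>inf (pprt (x - e)) e\<close> is disjoint from \<open>e - inf x e\<close>, and its image under \<open>S\<close> is disjoint from
  \<open>R e - R (inf x e)\<close>: where that image does not vanish, \<open>R\<close> takes its largest possible value
  \<open>R e = S e\<close> on the current layer \<open>inf x e\<close>. Comparing layers shifted by one is what makes the
  induction work: the statement \<open>S x \<le> R x + S e\<close> would lose another \<open>S e\<close> in each step.
\<close>

lemma layerwise_le:
  fixes S R :: "'g::lattice_ab_group_add \<Rightarrow> 'h::lattice_ab_group_add"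
  assumes S: "positive_homomorphism S" and R: "positive_homomorphism R"
    and disj: "\<And>c d. inf c d = 0 \<Longrightarrow> inf (S c) (R d) = 0"
    and agree: "S e = R e" and e: "0 \<le> e"
  shows "0 \<le> x \<Longrightarrow> x \<le> multiple n e \<Longrightarrow> S (pprt (x - e)) \<le> R x"
proof (induction n arbitrary: x)
  case 0
  then have "x = 0"
    by simp
  with e show ?case
    using S R by (simp add: positive_homomorphism_def additive.zero)
next
  case (Suc n)
  interpret S: additive S
    using S by (simp add: positive_homomorphism_def)
  interpret R: additive R
    using R by (simp add: positive_homomorphism_def)
  let ?y = "pprt (x - e)"
  have "inf (inf ?y e) (e - inf x e) = 0"
  proof (rule disjoint_mono)
    show "inf ?y (e - inf x e) = 0"
      using disjoint_diff_inf[of x e] by (simp only: diff_inf_eq_pprt)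
    show "0 \<le> inf ?y e"
      using e pprt_nonneg by simp
    show "0 \<le> e - inf x e"
      by (simp only: diff_ge_0_iff_ge inf_le2)
  qed (simp, rule order.refl)
  then have "inf (S (inf ?y e)) (R e - R (inf x e)) = 0"
    using disj by (simp flip: R.diff)
  then have "S (inf ?y e) + (R e - R (inf x e)) = sup (S (inf ?y e)) (R e - R (inf x e))"
    by (simp add: disjoint_add_eq_sup)
  also have "\<dots> \<le> R e"
  proof (rule sup_least)
    show "S (inf ?y e) \<le> R e"
      unfolding agree[symmetric] by (rule positive_homomorphism_mono[OF S]) simp
    show "R e - R (inf x e) \<le> R e"
      using positive_homomorphism_nonneg[OF R, of "inf x e"] Suc.prems e by simp
  qed
  finally have layer: "S (inf ?y e) \<le> R (inf x e)"
    by (simp add: algebra_simps)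
  have "?y \<le> multiple n e"
    using Suc.prems e by (intro pprt_least) (simp_all add: diff_le_eq multiple_nonneg)
  then have "S (pprt (?y - e)) \<le> R ?y"
    by (intro Suc.IH pprt_nonneg)
  with layer have "S (inf ?y e) + S (pprt (?y - e)) \<le> R (inf x e) + R ?y"
    by (rule add_mono)
  then show ?case
    by (simp add: inf_add_pprt_diff flip: S.add R.add)
qed

text \<open>For \<open>a\<close> below a multiple of \<open>e\<close>, layering the element \<open>n * a\<close> bounds \<open>n * (S a - R a)\<close> by
  \<open>S e\<close>, uniformly in \<open>n\<close>.\<close>

lemma positive_map_le_bounded:
  fixes S R :: "'g::lattice_ab_group_add \<Rightarrow> 'h::archimedean_f_ring"
  assumes S: "positive_homomorphism S" and R: "positive_homomorphism R"
    and disj: "\<And>c d. inf c d = 0 \<Longrightarrow> inf (S c) (R d) = 0"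
    and agree: "S e = R e" and e: "0 \<le> e"
    and a: "0 \<le> a" "a \<le> multiple k e"
  shows "S a \<le> R a"
proof -
  interpret S: additive S
    using S by (simp add: positive_homomorphism_def)
  interpret R: additive R
    using R by (simp add: positive_homomorphism_def)
  have "multiple n (S a - R a) \<le> S e" for n
  proof -
    let ?x = "multiple n a"
    have "?x \<le> multiple (n * k) e"
      using multiple_mono[OF a(2), of n] by (simp add: multiple_multiple)
    then have "S (pprt (?x - e)) \<le> R ?x"
      by (intro layerwise_le[OF S R disj agree e] multiple_nonneg a(1))
    moreover have "S (?x - e) \<le> S (pprt (?x - e))"
      by (rule positive_homomorphism_mono[OF S pprt_ge])
    ultimately have "S ?x - S e \<le> R ?x"
      by (simp add: S.diff)
    then show ?thesis
      by (simp add: multiple_diff additive_multiple S.additive_axioms R.additive_axioms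
          algebra_simps)
  qed
  then have "S a - R a \<le> 0"
    by (rule archimedean_nonpos)
  then show ?thesis
    by simp
qed

text \<open>The truncation \<open>inf a (n * e)\<close> is covered by the bounded case, and \<open>n\<close> times the excess of
  \<open>a\<close> over it is at most \<open>a * a\<close>; so \<open>n * (S a - R a) \<le> S (a * a)\<close>.\<close>

lemma positive_map_le:
  fixes S R :: "'g::f_ring \<Rightarrow> 'h::archimedean_f_ring"
  assumes unit: "\<And>a. e * a = a" and e: "0 \<le> e"
    and S: "positive_homomorphism S" and R: "positive_homomorphism R"
    and disj: "\<And>c d. inf c d = 0 \<Longrightarrow> inf (S c) (R d) = 0"
    and agree: "S e = R e" and a: "0 \<le> a"
  shows "S a \<le> R a"
proof -
  interpret S: additive S
    using S by (simp add: positive_homomorphism_def)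
  interpret R: additive R
    using R by (simp add: positive_homomorphism_def)
  have "multiple n (S a - R a) \<le> S (a * a)" for n
  proof -
    let ?b = "inf a (multiple n e)" and ?c = "pprt (a - multiple n e)"
    have a_eq: "a = ?b + ?c"
      by (simp add: inf_add_pprt_diff)
    have "S ?b \<le> R ?b"
      by (rule positive_map_le_bounded[OF S R disj agree e, where k = n])
        (simp_all add: a e multiple_nonneg)
    moreover have "0 \<le> R ?c"
      by (rule positive_homomorphism_nonneg[OF R pprt_nonneg])
    ultimately have "S ?b \<le> R ?b + R ?c"
      by (rule add_increasing2[rotated])
    then have "S a - R a \<le> S ?c"
      using S.add[of ?b ?c] R.add[of ?b ?c] a_eq by (simp add: algebra_simps)
    then have "multiple n (S a - R a) \<le> S (multiple n ?c)"
      using multiple_mono by (simp add: additive_multiple S.additive_axioms)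
    also have "\<dots> \<le> S (a * a)"
      by (rule positive_homomorphism_mono[OF S multiple_excess_le_square[OF unit e a]])
    finally show ?thesis .
  qed
  then have "S a - R a \<le> 0"
    by (rule archimedean_nonpos)
  then show ?thesis
    by simp
qed

lemma positive_maps_agree:
  fixes S R :: "'g::f_ring \<Rightarrow> 'h::archimedean_f_ring"
  assumes unit: "\<And>a. e * a = a" and e: "0 \<le> e"
    and S: "positive_homomorphism S" and R: "positive_homomorphism R"
    and disj: "\<And>c d. inf c d = 0 \<Longrightarrow> inf (S c) (R d) = 0"
    and agree: "S e = R e"
  shows "S a = R a"
proof -
  have disj': "inf (R c) (S d) = 0" if "inf c d = 0" for c d
    using disj[of d c] that by (simp add: inf_commute)
  have nonneg: "S c = R c" if "0 \<le> c" for c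
    using positive_map_le[OF unit e S R disj agree that]
      positive_map_le[OF unit e R S disj' agree[symmetric] that]
    by (rule order.antisym)
  have "S (pprt a - pprt (- a)) = R (pprt a - pprt (- a))"
    using S R by (simp add: positive_homomorphism_def additive.diff nonneg pprt_nonneg)
  then show ?thesis
    by (simp add: pprt_minus_pprt_uminus)
qed

section \<open>Ring homomorphisms and lattice homomorphisms\<close>

lemma ring_homomorphism_imp_l_homomorphism:
  fixes T :: "'g::f_ring \<Rightarrow> 'h::archimedean_f_ring" and e :: 'g
  assumes unit: "\<And>a. e * a = a" and e: "0 \<le> e"
    and T: "positive_homomorphism T" and ring: "ring_homomorphism T"
  shows "l_homomorphism T"
proof (rule l_homomorphismI_disjoint)
  show "additive T"
    using ring by (simp add: ring_homomorphism_def)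
  then have T0: "T 0 = 0"
    by (rule additive.zero)
  have mult: "T (a * b) = T a * T b" for a b
    using ring by (simp add: ring_homomorphism_def)
  have p: "0 \<le> T e"
    using T e by (rule positive_homomorphism_nonneg)
  fix a b :: 'g
  assume ab: "inf a b = 0"
  let ?x = "inf (T a) (T b)"
  have Tab: "0 \<le> T a" "0 \<le> T b"
    using disjoint_nonneg[OF ab] positive_homomorphism_nonneg[OF T] by simp_all
  then have x: "0 \<le> ?x"
    by simp
  have "?x * ?x \<le> T a * T b"
    using Tab x by (intro mult_mono) simp_all
  also have "\<dots> = 0"
    by (simp only: mult[symmetric] disjoint_mult_eq_0[OF ab] T0)
  finally have "?x * ?x = 0"
    using square_nonneg by (rule order.antisym)
  then have "T e * ?x = 0"
    using square_zero_imp_annihilates(2) x p by blast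
  moreover have "T e * ?x = ?x"
    using p by (simp only: mult_inf_distrib_left mult[symmetric] unit)
  ultimately show "?x = 0"
    by simp
qed

lemma l_homomorphism_imp_ring_homomorphism:
  fixes T :: "'g::f_ring \<Rightarrow> 'h::archimedean_f_ring"
  assumes unit: "\<And>a. e * a = a" and e: "0 \<le> e"
    and T: "positive_homomorphism T" and l: "l_homomorphism T"
    and idem: "T e * T e = T e"
  shows "ring_homomorphism T"
proof -
  interpret additive T
    using T by (simp add: positive_homomorphism_def)
  have disj: "inf (T c) (T d) = 0" if "inf c d = 0" for c d
  proof -
    have "inf (T c) (T d) = T (inf c d)"
      using l by (simp add: l_homomorphism_def)
    then show ?thesis
      by (simp add: that zero)
  qed
  have mult_nonneg: "T (a * b) = T a * T b" if b: "0 \<le> b" for a b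
  proof (rule positive_maps_agree[OF unit e,
        where S = "\<lambda>a. T (a * b)" and R = "\<lambda>a. T a * T b"])
    have Tb: "0 \<le> T b"
      using T b by (rule positive_homomorphism_nonneg)
    show "positive_homomorphism (\<lambda>a. T (a * b))"
      using T b by (simp add: positive_homomorphism_def additive_def distrib_right mult_nonneg_nonneg)
    show "positive_homomorphism (\<lambda>a. T a * T b)"
      using T Tb by (simp add: positive_homomorphism_def additive_def distrib_right mult_nonneg_nonneg)
    show "inf (T (c * b)) (T d * T b) = 0" if "inf c d = 0" for c d
    proof -
      have "inf (T d) (T (c * b)) = 0"
        using disj[OF inf_mult_right_eq_0[OF that b]] by (simp add: inf_commute)
      from inf_mult_right_eq_0[OF this Tb] show ?thesis
        by (simp add: inf_commute)
    qed
    show "T (e * b) = T e * T b"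
      using idempotent_image_mult[OF unit e T idem b] by (simp add: unit)
  qed
  have "T (a * b) = T a * T b" for a b
  proof -
    have "T (a * (pprt b - pprt (- b))) = T a * T (pprt b - pprt (- b))"
      by (simp add: right_diff_distrib diff mult_nonneg pprt_nonneg)
    then show ?thesis
      by (simp add: pprt_minus_pprt_uminus)
  qed
  then show ?thesis
    by (simp add: ring_homomorphism_def additive_axioms)
qed

theorem proposition1:
  fixes T :: "'g::f_ring \<Rightarrow> 'h::archimedean_f_ring"
    and e :: 'g
  assumes unit_left: "\<And>a. e * a = a"
    and unit_right: "\<And>a. a * e = a"
    and T: "positive_homomorphism T"
  shows "ring_homomorphism T \<longleftrightarrow> l_homomorphism T \<and> T e * T e = T e"
proof -
  have e: "0 \<le> e"
    using square_nonneg[of e] by (simp add: unit_left)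
  have idem: "T e * T e = T e" if "ring_homomorphism T"
    using that unit_left[of e] unfolding ring_homomorphism_def by metis
  show ?thesis
  proof (intro iffI conjI)
    assume "ring_homomorphism T"
    then show "l_homomorphism T" "T e * T e = T e"
      by (rule ring_homomorphism_imp_l_homomorphism[OF unit_left e T], rule idem)
  next
    assume "l_homomorphism T \<and> T e * T e = T e"
    then show "ring_homomorphism T"
      by (intro l_homomorphism_imp_ring_homomorphism[OF unit_left e T]) simp_all
  qed
qed

end
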